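(* Let $m,n$ be positive integers, $\mathfrak{g}=\mathfrak{gl}_{m\vert n}$ over $\mathbb{K}$, and let $B\in\mathfrak{g}_1$ be the element of rank $r$ in normal form, i.e. whose upper-right $m\times n$ block is $\begin{pmatrix} I_r & 0\\ 0&0\end{pmatrix}$. Identify elements of $\mathfrak{g}_{-1}$ with their lower-left $n\times m$ blocks. Then the center $Z(\mathfrak{g}^B_{-1})$ of the Lie algebra $\mathfrak{g}^B_{-1}$ is as follows. (a) If $r=m=n$, then $Z(\mathfrak{g}^B_{-1})=\{\alpha I_r:\alpha\in\mathbb{K}\}$. (b) If $r\neq m$ and $r\neq n$, then $Z(\mathfrak{g}^B_{-1})=\left\{\begin{pmatrix}0&0\\0&y_{22}\end{pmatrix}: y_{22}\in M_{(n-r)\times(m-r)}(\mathbb{K})\right\}$, where the blocks are taken with respect to the row partition $(r,n-r)$ and column partition $(r,m-r)$. (c) If $r=m$ or $r=n$ (but not both), then $Z(\mathfrak{g}^B_{-1})=\{0\}$.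
   Context: $\mathbb{K}$ is a field of characteristic zero. $\mathfrak{gl}_{m\vert n}$ is the Lie superalgebra of $(m+n)\times(m+n)$ matrices $\begin{pmatrix} A & B\\ C& D\end{pmatrix}$ over $\mathbb{K}$ ($A$ of size $m\times m$, $B$ of size $m\times n$, $C$ of size $n\times m$, $D$ of size $n\times n$), with even part the block diagonal matrices, odd part the block off-diagonal matrices, and superbracket $[X,Y]=XY-(-1)^{(\deg X)(\deg Y)}YX$ for homogeneous $X,Y$. It is $\mathbb{Z}$-graded, $\mathfrak{g}=\mathfrak{g}_{-1}\oplus\mathfrak{g}_0\oplus\mathfrak{g}_1$, where $\mathfrak{g}_0$ consists of the block diagonal matrices, $\mathfrak{g}_{1}$ of the matrices $\begin{pmatrix}0&\mathbf{b}\\0&0\end{pmatrix}$ and $\mathfrak{g}_{-1}$ of the matrices $\begin{pmatrix}0&0\\ \mathbf{c}&0\end{pmatrix}$. For $B\in\mathfrak{g}_1$, $\mathfrak{g}^B_{-1}$ denotes the vector space $\mathfrak{g}_{-1}$ with the derived bracket $\llbracket X,Y\rrbracket_B=[X,[B,Y]]$, $X,Y\in\mathfrak{g}_{-1}$; this is a Lie algebra over $\mathbb{K}$. *)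

theory Defs
  imports "Jordan_Normal_Form.VS_Connect"
begin

section \<open>Lie algebras and their center\<close>

locale lie_algebra = vectorspace K L
  for K :: "('k, 'c) ring_scheme" and L :: "('k, 'a, 'b) module_scheme" +
  fixes br :: "'a \<Rightarrow> 'a \<Rightarrow> 'a"
  assumes br_closed: "x \<in> carrier L \<Longrightarrow> y \<in> carrier L \<Longrightarrow> br x y \<in> carrier L"
    and br_add_left: "x \<in> carrier L \<Longrightarrow> y \<in> carrier L \<Longrightarrow> z \<in> carrier L \<Longrightarrow>
      br (x \<oplus>\<^bsub>L\<^esub> y) z = br x z \<oplus>\<^bsub>L\<^esub> br y z"
    and br_add_right: "x \<in> carrier L \<Longrightarrow> y \<in> carrier L \<Longrightarrow> z \<in> carrier L \<Longrightarrow>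
      br x (y \<oplus>\<^bsub>L\<^esub> z) = br x y \<oplus>\<^bsub>L\<^esub> br x z"
    and br_smult_left: "a \<in> carrier K \<Longrightarrow> x \<in> carrier L \<Longrightarrow> y \<in> carrier L \<Longrightarrow>
      br (a \<odot>\<^bsub>L\<^esub> x) y = a \<odot>\<^bsub>L\<^esub> br x y"
    and br_smult_right: "a \<in> carrier K \<Longrightarrow> x \<in> carrier L \<Longrightarrow> y \<in> carrier L \<Longrightarrow>
      br x (a \<odot>\<^bsub>L\<^esub> y) = a \<odot>\<^bsub>L\<^esub> br x y"
    and br_self: "x \<in> carrier L \<Longrightarrow> br x x = \<zero>\<^bsub>L\<^esub>"
    and br_jacobi: "x \<in> carrier L \<Longrightarrow> y \<in> carrier L \<Longrightarrow> z \<in> carrier L \<Longrightarrow>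
      br x (br y z) \<oplus>\<^bsub>L\<^esub> br y (br z x) \<oplus>\<^bsub>L\<^esub> br z (br x y) = \<zero>\<^bsub>L\<^esub>"

definition lie_center :: "('k, 'a, 'b) module_scheme \<Rightarrow> ('a \<Rightarrow> 'a \<Rightarrow> 'a) \<Rightarrow> 'a set" where
  "lie_center L br = {z \<in> carrier L. \<forall>x \<in> carrier L. br z x = \<zero>\<^bsub>L\<^esub>}"


section \<open>The general linear Lie superalgebra\<close>

definition gl_even :: "nat \<Rightarrow> nat \<Rightarrow> 'a :: field mat set" where
  "gl_even m n = {four_block_mat A (0\<^sub>m m n) (0\<^sub>m n m) D | A D.
     A \<in> carrier_mat m m \<and> D \<in> carrier_mat n n}"

definition gl_odd :: "nat \<Rightarrow> nat \<Rightarrow> 'a :: field mat set" where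
  "gl_odd m n = {four_block_mat (0\<^sub>m m m) B C (0\<^sub>m n n) | B C.
     B \<in> carrier_mat m n \<and> C \<in> carrier_mat n m}"

text \<open>The homogeneous components of a matrix; \<open>m\<close> is the size of the upper left block.\<close>

definition even_part :: "nat \<Rightarrow> 'a :: field mat \<Rightarrow> 'a mat" where
  "even_part m X = mat (dim_row X) (dim_col X) (\<lambda>(i, j). if (i < m) = (j < m) then X $$ (i, j) else 0)"

definition odd_part :: "nat \<Rightarrow> 'a :: field mat \<Rightarrow> 'a mat" where
  "odd_part m X = mat (dim_row X) (dim_col X) (\<lambda>(i, j). if (i < m) = (j < m) then 0 else X $$ (i, j))"

text \<open>The bilinear extension of \<open>[X, Y] = XY - (-1)^(deg X deg Y) YX\<close> from homogeneous
  elements to all of \<open>gl(m|n)\<close>; see \<open>superbracket_homogeneous\<close> below.\<close>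

definition superbracket :: "nat \<Rightarrow> 'a :: field mat \<Rightarrow> 'a mat \<Rightarrow> 'a mat" where
  "superbracket m X Y =
     (let X0 = even_part m X; X1 = odd_part m X; Y0 = even_part m Y; Y1 = odd_part m Y
      in (X0 * Y0 - Y0 * X0) + (X0 * Y1 - Y1 * X0) + (X1 * Y0 - Y0 * X1) + (X1 * Y1 + Y1 * X1))"

text \<open>The matrices of degree \<open>1\<close> and \<open>-1\<close> with a given off-diagonal block.\<close>

definition gl_upper :: "nat \<Rightarrow> nat \<Rightarrow> 'a :: field mat \<Rightarrow> 'a mat" where
  "gl_upper m n b = four_block_mat (0\<^sub>m m m) b (0\<^sub>m n m) (0\<^sub>m n n)"

definition gl_lower :: "nat \<Rightarrow> nat \<Rightarrow> 'a :: field mat \<Rightarrow> 'a mat" where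
  "gl_lower m n c = four_block_mat (0\<^sub>m m m) (0\<^sub>m m n) c (0\<^sub>m n n)"

definition gl_plus1 :: "nat \<Rightarrow> nat \<Rightarrow> 'a :: field mat set" where
  "gl_plus1 m n = gl_upper m n ` carrier_mat m n"

definition gl_minus1 :: "nat \<Rightarrow> nat \<Rightarrow> 'a :: field mat set" where
  "gl_minus1 m n = gl_lower m n ` carrier_mat n m"

text \<open>\<open>gl_minus1 m n\<close> as a subspace of the space of all \<open>(m+n) \<times> (m+n)\<close> matrices.\<close>

definition gl_minus1_space :: "nat \<Rightarrow> nat \<Rightarrow> ('a :: field, 'a mat) module" where
  "gl_minus1_space m n = (module_mat TYPE('a) (m + n) (m + n)) \<lparr>carrier := gl_minus1 m n\<rparr>"

definition derived_bracket :: "nat \<Rightarrow> 'a :: field mat \<Rightarrow> 'a mat \<Rightarrow> 'a mat \<Rightarrow> 'a mat" where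
  "derived_bracket m B X Y = superbracket m X (superbracket m B Y)"

definition rank_normal_form :: "nat \<Rightarrow> nat \<Rightarrow> nat \<Rightarrow> 'a :: field mat" where
  "rank_normal_form m n r =
     four_block_mat (1\<^sub>m r) (0\<^sub>m r (n - r)) (0\<^sub>m (m - r) r) (0\<^sub>m (m - r) (n - r))"


section \<open>Basic properties\<close>

lemma even_part_even:
  assumes "X \<in> gl_even m n" shows "even_part m X = X" "odd_part m X = 0\<^sub>m (m + n) (m + n)"
  using assms unfolding gl_even_def even_part_def odd_part_def
  by (auto intro!: eq_matI)

lemma even_part_odd:
  assumes "X \<in> gl_odd m n" shows "even_part m X = 0\<^sub>m (m + n) (m + n)" "odd_part m X = X"
  using assms unfolding gl_odd_def even_part_def odd_part_def
  by (auto intro!: eq_matI)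

lemma gl_even_carrier: "X \<in> gl_even m n \<Longrightarrow> X \<in> carrier_mat (m + n) (m + n)"
  unfolding gl_even_def by auto

lemma gl_odd_carrier: "X \<in> gl_odd m n \<Longrightarrow> X \<in> carrier_mat (m + n) (m + n)"
  unfolding gl_odd_def by auto

lemma superbracket_homogeneous:
  fixes p q :: nat and X Y :: "'a :: field mat"
  assumes "X \<in> (if even p then gl_even m n else gl_odd m n)"
    and "Y \<in> (if even q then gl_even m n else gl_odd m n)"
  shows "superbracket m X Y = X * Y - (-1) ^ (p * q) \<cdot>\<^sub>m (Y * X)"
proof -
  have X: "X \<in> carrier_mat (m + n) (m + n)" and Y: "Y \<in> carrier_mat (m + n) (m + n)"
    using assms by (simp_all add: gl_even_carrier gl_odd_carrier split: if_splits)
  have XY: "X * Y \<in> carrier_mat (m + n) (m + n)" and YX: "Y * X \<in> carrier_mat (m + n) (m + n)"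
    using X Y by auto
  let ?O = "0\<^sub>m (m + n) (m + n) :: 'a mat"
  note zero = left_mult_zero_mat[OF X] left_mult_zero_mat[OF Y]
    right_mult_zero_mat[OF X] right_mult_zero_mat[OF Y]
  have O: "?O * ?O = ?O" by simp
  have sign: "(-1 :: 'a) ^ (p * q) = (if odd p \<and> odd q then -1 else 1)"
    by (simp add: minus_one_power_iff)
  have pX: "even_part m X = (if even p then X else ?O)" "odd_part m X = (if even p then ?O else X)"
    using assms(1) by (simp_all add: even_part_even even_part_odd split: if_splits)
  have pY: "even_part m Y = (if even q then Y else ?O)" "odd_part m Y = (if even q then ?O else Y)"
    using assms(2) by (simp_all add: even_part_even even_part_odd split: if_splits)
  have minus0: "?O - ?O = ?O" and add0: "?O + ?O = ?O" by simp_all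
  have left0: "?O + A = A" and right0: "A + ?O = A"
    if "A \<in> carrier_mat (m + n) (m + n)" for A
    using that by simp_all
  have D: "X * Y - Y * X \<in> carrier_mat (m + n) (m + n)" "X * Y + Y * X \<in> carrier_mat (m + n) (m + n)"
    by (rule minus_carrier_mat[OF YX], rule add_carrier_mat[OF YX])
  have one: "X * Y - 1 \<cdot>\<^sub>m (Y * X) = X * Y - Y * X"
    and minus: "X * Y - (-1) \<cdot>\<^sub>m (Y * X) = X * Y + Y * X"
    using XY YX by (intro eq_matI; simp)+
  show ?thesis
    unfolding superbracket_def Let_def pX pY sign
    by (cases "even p"; cases "even q";
        simp only: if_True if_False simp_thms zero O minus0 add0 left0[OF D(1)] right0[OF D(1)]
          left0[OF D(2)] right0[OF D(2)] one minus)
qed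

lemma gl_oddI:
  assumes "b \<in> carrier_mat m n" "c \<in> carrier_mat n m"
  shows "four_block_mat (0\<^sub>m m m) b c (0\<^sub>m n n) \<in> gl_odd m n"
  unfolding gl_odd_def by (rule CollectI, intro exI, rule conjI[OF refl], rule conjI[OF assms])

lemma gl_evenI:
  assumes "A \<in> carrier_mat m m" "D \<in> carrier_mat n n"
  shows "four_block_mat A (0\<^sub>m m n) (0\<^sub>m n m) D \<in> gl_even m n"
  unfolding gl_even_def by (rule CollectI, intro exI, rule conjI[OF refl], rule conjI[OF assms])

lemma gl_lower_carrier: "c \<in> carrier_mat n m \<Longrightarrow> gl_lower m n c \<in> carrier_mat (m + n) (m + n)"
  unfolding gl_lower_def by auto

lemma block_diag_minus_smult:
  fixes P Q :: "'a :: field mat"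
  assumes "P \<in> carrier_mat m m" "Q \<in> carrier_mat n n"
  shows "four_block_mat P (0\<^sub>m m n) (0\<^sub>m n m) (0\<^sub>m n n)
      - (-1) \<cdot>\<^sub>m four_block_mat (0\<^sub>m m m) (0\<^sub>m m n) (0\<^sub>m n m) Q
    = four_block_mat P (0\<^sub>m m n) (0\<^sub>m n m) Q"
  using carrier_matD[OF assms(1)] carrier_matD[OF assms(2)]
  by (intro eq_matI) simp_all

lemma gl_lower_minus: "x \<in> carrier_mat n m \<Longrightarrow> y \<in> carrier_mat n m \<Longrightarrow>
    gl_lower m n x - gl_lower m n y = gl_lower m n (x - y)"
  unfolding gl_lower_def by (intro eq_matI) auto

lemma gl_lower_smult: "x \<in> carrier_mat n m \<Longrightarrow> a \<cdot>\<^sub>m gl_lower m n x = gl_lower m n (a \<cdot>\<^sub>m x)"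
  unfolding gl_lower_def by (intro eq_matI) auto

lemma derived_bracket_blocks:
  assumes b: "b \<in> carrier_mat m n" and x: "x \<in> carrier_mat n m" and y: "y \<in> carrier_mat n m"
  shows "derived_bracket m (gl_upper m n b) (gl_lower m n x) (gl_lower m n y)
    = gl_lower m n (x * b * y - y * b * x)"
proof -
  let ?B = "gl_upper m n b" and ?X = "gl_lower m n x" and ?Y = "gl_lower m n y"
  have odd: "?B \<in> gl_odd m n" "?X \<in> gl_odd m n" "?Y \<in> gl_odd m n"
    unfolding gl_upper_def gl_lower_def by (rule gl_oddI, use b x y in simp_all)+
  have c: "b * y \<in> carrier_mat m m" "y * b \<in> carrier_mat n n" using b y by auto
  have BY: "?B * ?Y = four_block_mat (b * y) (0\<^sub>m m n) (0\<^sub>m n m) (0\<^sub>m n n)"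
    unfolding gl_upper_def gl_lower_def
    by (subst mult_four_block_mat[of _ m m _ n _ n]) (use b y in auto)
  have YB: "?Y * ?B = four_block_mat (0\<^sub>m m m) (0\<^sub>m m n) (0\<^sub>m n m) (y * b)"
    unfolding gl_upper_def gl_lower_def
    by (subst mult_four_block_mat[of _ m m _ n _ n]) (use b y in auto)
  let ?E = "four_block_mat (b * y) (0\<^sub>m m n) (0\<^sub>m n m) (y * b)"
  have "superbracket m ?B ?Y = ?B * ?Y - (-1) ^ (1 * 1) \<cdot>\<^sub>m (?Y * ?B)"
    by (rule superbracket_homogeneous[where p = 1 and q = 1 and n = n]) (use odd in auto)
  also have "\<dots> = ?E"
    unfolding BY YB using block_diag_minus_smult[OF c] by simp
  finally have E: "superbracket m ?B ?Y = ?E" .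
  have ev: "?E \<in> gl_even m n" by (rule gl_evenI[OF c])
  have XE: "?X * ?E = gl_lower m n (x * (b * y))"
    unfolding gl_lower_def
    by (subst mult_four_block_mat[of _ m m _ n _ n]) (use x c left_mult_zero_mat[OF c(1)] left_mult_zero_mat[OF c(2)]
      right_mult_zero_mat[OF c(1)] right_mult_zero_mat[OF c(2)] in auto)
  have EX: "?E * ?X = gl_lower m n (y * b * x)"
    unfolding gl_lower_def
    by (subst mult_four_block_mat[of _ m m _ n _ n]) (use x c left_mult_zero_mat[OF c(1)] left_mult_zero_mat[OF c(2)]
      right_mult_zero_mat[OF c(1)] right_mult_zero_mat[OF c(2)] in auto)
  have p: "x * (b * y) \<in> carrier_mat n m" "y * b * x \<in> carrier_mat n m"
    using x b y by auto
  have one_p: "1 \<cdot>\<^sub>m (y * b * x) = y * b * x" by (rule eq_matI) simp_all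
  have "superbracket m ?X ?E = ?X * ?E - (-1) ^ (1 * 0) \<cdot>\<^sub>m (?E * ?X)"
    by (rule superbracket_homogeneous[where p = 1 and q = 0 and n = n]) (use odd ev in auto)
  also have "\<dots> = gl_lower m n (x * (b * y) - y * b * x)"
    unfolding XE EX using one_p gl_lower_smult[OF p(2), of 1] gl_lower_minus[OF p] by simp
  also have "x * (b * y) = x * b * y" by (rule assoc_mult_mat[OF x b y, symmetric])
  finally show ?thesis unfolding derived_bracket_def E .
qed

lemma gl_lower_add: "x \<in> carrier_mat n m \<Longrightarrow> y \<in> carrier_mat n m \<Longrightarrow>
    gl_lower m n x + gl_lower m n y = gl_lower m n (x + y)"
  unfolding gl_lower_def by (intro eq_matI) auto

lemma gl_lower_zero: "gl_lower m n (0\<^sub>m n m) = 0\<^sub>m (m + n) (m + n)"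
  unfolding gl_lower_def by (intro eq_matI) auto

lemma gl_minus1_space_simps:
  "carrier (gl_minus1_space m n) = gl_minus1 m n"
  "add (gl_minus1_space m n) = (+)"
  "zero (gl_minus1_space m n) = 0\<^sub>m (m + n) (m + n)"
  "smult (gl_minus1_space m n) = (\<cdot>\<^sub>m)"
  unfolding gl_minus1_space_def module_mat_def by auto

lemma gl_minus1_E:
  assumes "X \<in> gl_minus1 m n" obtains x where "x \<in> carrier_mat n m" "X = gl_lower m n x"
  using assms unfolding gl_minus1_def by blast

lemma gl_minus1_vectorspace:
  "vectorspace (class_ring :: 'a :: field ring) (gl_minus1_space m n)"
proof -
  let ?W = "gl_minus1 m n :: 'a mat set"
  interpret V: vectorspace "class_ring :: 'a ring" "module_mat TYPE('a) (m + n) (m + n)"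
    by (rule matrix_vs)
  have "submodule (class_ring :: 'a ring) ?W (module_mat TYPE('a) (m + n) (m + n))"
  proof (unfold_locales, goal_cases)
    case 1
    show ?case using gl_lower_carrier by (auto simp: module_mat_simps gl_minus1_def)
  next
    case (2 v w)
    then show ?case
      by (auto simp: module_mat_simps gl_minus1_def gl_lower_add)
  next
    case 3
    show ?case
      unfolding module_mat_simps gl_minus1_def
      by (rule image_eqI[of _ _ "0\<^sub>m n m"]) (auto simp: gl_lower_zero)
  next
    case (4 c v)
    then show ?case by (auto simp: module_mat_simps gl_minus1_def gl_lower_smult)
  qed
  then have "subspace (class_ring :: 'a ring) ?W (module_mat TYPE('a) (m + n) (m + n))"
    unfolding subspace_def using V.vectorspace_axioms by blast
  from V.subspace_is_vs[OF this] show ?thesis unfolding gl_minus1_space_def .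
qed

lemma block_bracket_jacobi:
  fixes b x y z :: "'a :: field mat"
  assumes b: "b \<in> carrier_mat m n"
    and x: "x \<in> carrier_mat n m" and y: "y \<in> carrier_mat n m" and z: "z \<in> carrier_mat n m"
  defines "D \<equiv> \<lambda>u v. u * b * v - v * b * u"
  shows "D x (D y z) + D y (D z x) + D z (D x y) = 0\<^sub>m n m"
proof -
  define T where "T = (\<lambda>u v w. u * b * v * b * w)"
  have T: "T u v w \<in> carrier_mat n m"
    if "u \<in> carrier_mat n m" "v \<in> carrier_mat n m" "w \<in> carrier_mat n m" for u v w
    unfolding T_def
    by (rule mult_carrier_mat[OF mult_carrier_mat[OF mult_carrier_mat[OF mult_carrier_mat[OF that(1) b] that(2)] b] that(3)])
  have expand: "D u (D v w) = (T u v w - T u w v) - (T v w u - T w v u)"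
    if u: "u \<in> carrier_mat n m" and v: "v \<in> carrier_mat n m" and w: "w \<in> carrier_mat n m" for u v w
  proof -
    have ub: "u * b \<in> carrier_mat n n" and vb: "v * b \<in> carrier_mat n n" and wb: "w * b \<in> carrier_mat n n"
      using mult_carrier_mat[OF _ b] u v w by blast+
    have vw: "v * b * w \<in> carrier_mat n m" and wv: "w * b * v \<in> carrier_mat n m"
      using mult_carrier_mat[OF vb w] mult_carrier_mat[OF wb v] by auto
    have "u * b * (v * b * w - w * b * v) = T u v w - T u w v"
      unfolding mult_minus_distrib_mat[OF ub vw wv] T_def
      unfolding assoc_mult_mat[OF ub v b] assoc_mult_mat[OF ub w b]
        assoc_mult_mat[OF ub vb w] assoc_mult_mat[OF ub wb v] ..
    moreover have "(v * b * w - w * b * v) * b * u = T v w u - T w v u"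
      unfolding minus_mult_distrib_mat[OF vw wv b]
      unfolding minus_mult_distrib_mat[OF mult_carrier_mat[OF vw b] mult_carrier_mat[OF wv b] u] T_def ..
    ultimately show ?thesis unfolding D_def by simp
  qed
  note carr = carrier_matD[OF T[OF x y z]] carrier_matD[OF T[OF x z y]] carrier_matD[OF T[OF y x z]]
    carrier_matD[OF T[OF y z x]] carrier_matD[OF T[OF z x y]] carrier_matD[OF T[OF z y x]]
  show ?thesis
    unfolding expand[OF x y z] expand[OF y z x] expand[OF z x y]
    by (intro eq_matI) (simp_all add: carr)
qed

lemma lie_algebra_derived_bracket:
  fixes B :: "'a :: field mat"
  assumes "B \<in> gl_plus1 m n"
  shows "lie_algebra (class_ring :: 'a ring) (gl_minus1_space m n) (derived_bracket m B)"
proof -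
  obtain b where b: "b \<in> carrier_mat m n" and B: "B = gl_upper m n b"
    using assms unfolding gl_plus1_def by blast
  define D where "D = (\<lambda>u v. u * b * v - v * b * u)"
  have D: "D u v \<in> carrier_mat n m" if "u \<in> carrier_mat n m" "v \<in> carrier_mat n m" for u v
    unfolding D_def
    by (rule minus_carrier_mat[OF mult_carrier_mat[OF mult_carrier_mat[OF that(2) b] that(1)]])
  have br: "derived_bracket m B (gl_lower m n u) (gl_lower m n v) = gl_lower m n (D u v)"
    if "u \<in> carrier_mat n m" "v \<in> carrier_mat n m" for u v
    unfolding B D_def by (rule derived_bracket_blocks[OF b that])
  have memI: "gl_lower m n u \<in> gl_minus1 m n" if "u \<in> carrier_mat n m" for u :: "'a mat"
    unfolding gl_minus1_def by (rule imageI[OF that])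
  have add_left: "D (u + v) w = D u w + D v w" and add_right: "D w (u + v) = D w u + D w v"
    if u: "u \<in> carrier_mat n m" and v: "v \<in> carrier_mat n m" and w: "w \<in> carrier_mat n m" for u v w
  proof -
    have ub: "u * b \<in> carrier_mat n n" and vb: "v * b \<in> carrier_mat n n" and wb: "w * b \<in> carrier_mat n n"
      using mult_carrier_mat[OF _ b] u v w by blast+
    have 1: "(u + v) * b * w = u * b * w + v * b * w"
      unfolding add_mult_distrib_mat[OF u v b] by (rule add_mult_distrib_mat[OF ub vb w])
    have 2: "w * b * (u + v) = w * b * u + w * b * v"
      by (rule mult_add_distrib_mat[OF wb u v])
    note carr = carrier_matD[OF mult_carrier_mat[OF ub w]] carrier_matD[OF mult_carrier_mat[OF vb w]]
      carrier_matD[OF mult_carrier_mat[OF wb u]] carrier_matD[OF mult_carrier_mat[OF wb v]]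
    have sum: "(P + Q) - (R + S) = (P - R) + (Q - S)"
      if "P \<in> carrier_mat n m" "Q \<in> carrier_mat n m" "R \<in> carrier_mat n m" "S \<in> carrier_mat n m"
      for P Q R S :: "'a mat"
      by (intro eq_matI) (simp_all add: carrier_matD[OF that(1)] carrier_matD[OF that(2)]
          carrier_matD[OF that(3)] carrier_matD[OF that(4)])
    note M = mult_carrier_mat[OF ub w] mult_carrier_mat[OF vb w]
      mult_carrier_mat[OF wb u] mult_carrier_mat[OF wb v]
    show "D (u + v) w = D u w + D v w"
      unfolding D_def 1 2 by (rule sum[OF M])
    show "D w (u + v) = D w u + D w v"
      unfolding D_def 1 2 by (rule sum[OF M(3,4,1,2)])
  qed
  have smult_left: "D (a \<cdot>\<^sub>m u) v = a \<cdot>\<^sub>m D u v" and smult_right: "D u (a \<cdot>\<^sub>m v) = a \<cdot>\<^sub>m D u v"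
    if u: "u \<in> carrier_mat n m" and v: "v \<in> carrier_mat n m" for a u v
  proof -
    have ub: "u * b \<in> carrier_mat n n" and vb: "v * b \<in> carrier_mat n n"
      using mult_carrier_mat[OF _ b] u v by blast+
    have 1: "a \<cdot>\<^sub>m u * b * v = a \<cdot>\<^sub>m (u * b * v)" "v * b * (a \<cdot>\<^sub>m u) = a \<cdot>\<^sub>m (v * b * u)"
      unfolding mult_smult_assoc_mat[OF u b]
      by (rule mult_smult_assoc_mat[OF ub v], rule mult_smult_distrib[OF vb u])
    have 2: "a \<cdot>\<^sub>m v * b * u = a \<cdot>\<^sub>m (v * b * u)" "u * b * (a \<cdot>\<^sub>m v) = a \<cdot>\<^sub>m (u * b * v)"
      unfolding mult_smult_assoc_mat[OF v b]
      by (rule mult_smult_assoc_mat[OF vb u], rule mult_smult_distrib[OF ub v])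
    have sm: "a \<cdot>\<^sub>m P - a \<cdot>\<^sub>m Q = a \<cdot>\<^sub>m (P - Q)"
      if "P \<in> carrier_mat n m" "Q \<in> carrier_mat n m" for P Q :: "'a mat"
      by (intro eq_matI) (simp_all add: carrier_matD[OF that(1)] carrier_matD[OF that(2)] right_diff_distrib)
    note M = mult_carrier_mat[OF ub v] mult_carrier_mat[OF vb u]
    show "D (a \<cdot>\<^sub>m u) v = a \<cdot>\<^sub>m D u v" "D u (a \<cdot>\<^sub>m v) = a \<cdot>\<^sub>m D u v"
      unfolding D_def 1 2 by (rule sm[OF M])+
  qed
  have self: "D u u = 0\<^sub>m n m" if "u \<in> carrier_mat n m" for u
    unfolding D_def by (rule minus_r_inv_mat[OF mult_carrier_mat[OF mult_carrier_mat[OF that b] that]])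
  have jacobi: "D u (D v w) + D v (D w u) + D w (D u v) = 0\<^sub>m n m"
    if "u \<in> carrier_mat n m" "v \<in> carrier_mat n m" "w \<in> carrier_mat n m" for u v w
    unfolding D_def by (rule block_bracket_jacobi[OF b that])
  show ?thesis
  proof (intro lie_algebra.intro gl_minus1_vectorspace lie_algebra_axioms.intro,
      unfold gl_minus1_space_simps, goal_cases)
    case (1 x y)
    then show ?case by (elim gl_minus1_E) (simp add: br D memI)
  next
    case (2 x y z)
    then show ?case by (elim gl_minus1_E) (simp add: br D gl_lower_add add_left)
  next
    case (3 x y z)
    then show ?case by (elim gl_minus1_E) (simp add: br D gl_lower_add add_right)
  next
    case (4 a x y)
    then show ?case by (elim gl_minus1_E) (simp add: br D gl_lower_smult smult_left)
  next
    case (5 a x y)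
    then show ?case by (elim gl_minus1_E) (simp add: br D gl_lower_smult smult_right)
  next
    case (6 x)
    then show ?case by (elim gl_minus1_E) (simp add: br self gl_lower_zero)
  next
    case (7 x y z)
    then show ?case by (elim gl_minus1_E) (simp add: br D gl_lower_add jacobi gl_lower_zero)
  qed
qed

end

theory Submission
  imports Defs
begin

text \<open>Writing \<open>b\<close> for the normal form, the bracket of \<open>y\<close> and \<open>x\<close> is \<open>y b x - x b y\<close>. Testing
  centrality of \<open>y\<close> against the matrix units \<open>E\<^sub>p\<^sub>q\<close> gives
  \<open>[p < r] [j = q] y\<^sub>i\<^sub>p = [i = p] [q < r] y\<^sub>q\<^sub>j\<close> for all indices. Taking \<open>i = p\<close> or \<open>j = q\<close> shows that
  the first \<open>r\<close> rows and columns of \<open>y\<close> are constant on the diagonal and vanish off it; the constant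
  is \<open>0\<close> as soon as there is a row or column of index at least \<open>r\<close>.\<close>

lemma rank_normal_form_carrier:
  assumes "r \<le> m" "r \<le> n"
  shows "rank_normal_form m n r \<in> carrier_mat m n"
  using assms unfolding rank_normal_form_def by auto

lemma index_rank_normal_form:
  assumes "r \<le> m" "r \<le> n" "i < m" "j < n"
  shows "rank_normal_form m n r $$ (i, j) = (if i = j \<and> i < r then 1 else 0)"
  using assms unfolding rank_normal_form_def by auto

lemma index_mult_mat_sum:
  assumes "P \<in> carrier_mat l n" "Q \<in> carrier_mat n k" "i < l" "j < k"
  shows "(P * Q) $$ (i, j) = (\<Sum>t = 0..<n. P $$ (i, t) * Q $$ (t, j))"
  using assms by (simp add: scalar_prod_def)

text \<open>Right multiplication by the normal form keeps the first \<open>r\<close> columns of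
  \<open>x\<close> and clears the others, so only inner indices below \<open>r\<close> survive in
  the triple product.\<close>

lemma index_mult_rank_normal_form:
  fixes x y :: "'a :: field mat"
  assumes r: "r \<le> m" "r \<le> n"
    and x: "x \<in> carrier_mat l m" and y: "y \<in> carrier_mat n k"
    and i: "i < l" and j: "j < k"
  shows "(x * rank_normal_form m n r * y) $$ (i, j) = (\<Sum>s<r. x $$ (i, s) * y $$ (s, j))"
proof -
  let ?b = "rank_normal_form m n r :: 'a mat"
  have b: "?b \<in> carrier_mat m n" by (rule rank_normal_form_carrier[OF r])
  have xb: "x * ?b \<in> carrier_mat l n" using x b by simp
  have entry: "(x * ?b) $$ (i, t) = (if t < r then x $$ (i, t) else 0)" if t: "t < n" for t
  proof -
    have "(x * ?b) $$ (i, t) = (\<Sum>s = 0..<m. x $$ (i, s) * ?b $$ (s, t))"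
      by (rule index_mult_mat_sum[OF x b i t])
    \<comment> \<open>Only \<open>s = t\<close> can contribute; if \<open>t < r\<close>, then
      \<open>r\<close> \<le> \<open>m\<close> puts that index inside the range.\<close>
    also have "\<dots> = (\<Sum>s = 0..<m. if s = t then (if t < r then x $$ (i, t) else 0) else 0)"
      by (rule sum.cong) (use t r in \<open>auto simp: index_rank_normal_form\<close>)
    also have "\<dots> = (if t < r then x $$ (i, t) else 0)" using r by simp
    finally show ?thesis .
  qed
  have "(x * ?b * y) $$ (i, j) = (\<Sum>t = 0..<n. (x * ?b) $$ (i, t) * y $$ (t, j))"
    by (rule index_mult_mat_sum[OF xb y i j])
  also have "\<dots> = (\<Sum>t = 0..<n. (if t < r then x $$ (i, t) else 0) * y $$ (t, j))"
    by (rule sum.cong) (simp_all add: entry)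
  also have "\<dots> = (\<Sum>s<r. x $$ (i, s) * y $$ (s, j))"
    by (rule sum.mono_neutral_cong_right) (use r in auto)
  finally show ?thesis .
qed

lemma gl_lower_eq_zero_iff:
  assumes c: "c \<in> carrier_mat n m"
  shows "gl_lower m n c = 0\<^sub>m (m + n) (m + n) \<longleftrightarrow> c = 0\<^sub>m n m"
proof
  assume 0: "gl_lower m n c = 0\<^sub>m (m + n) (m + n)"
  have "c $$ (i, j) = 0" if "i < n" "j < m" for i j
  proof -
    have "gl_lower m n c $$ (m + i, j) = c $$ (i, j)"
      using c that unfolding gl_lower_def by simp
    then show ?thesis using 0 that by simp
  qed
  then show "c = 0\<^sub>m n m" using c by (intro eq_matI) auto
qed (simp add: gl_lower_zero)

lemma minus_eq_zero_mat_iff: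
  fixes P Q :: "'a :: ab_group_add mat"
  assumes "P \<in> carrier_mat n m" "Q \<in> carrier_mat n m"
  shows "P - Q = 0\<^sub>m n m \<longleftrightarrow> P = Q"
  using assms by (auto simp: mat_eq_iff)

text \<open>Reduces the center to a condition on lower-left blocks, for an arbitrary
  \<open>b\<close>: the bracket is \<open>gl_lower\<close> of a difference of triple products, and
  \<open>gl_lower\<close> vanishes only at zero.\<close>

lemma lie_center_gl_minus1:
  assumes b: "b \<in> carrier_mat m n"
  shows "lie_center (gl_minus1_space m n) (derived_bracket m (gl_upper m n b))
    = gl_lower m n ` {y \<in> carrier_mat n m. \<forall>x \<in> carrier_mat n m. y * b * x = x * b * y}"
proof -
  have "derived_bracket m (gl_upper m n b) (gl_lower m n y) (gl_lower m n x) = 0\<^sub>m (m + n) (m + n)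
      \<longleftrightarrow> y * b * x = x * b * y"
    if x: "x \<in> carrier_mat n m" and y: "y \<in> carrier_mat n m" for x y
  proof -
    have P: "y * b * x \<in> carrier_mat n m" "x * b * y \<in> carrier_mat n m"
      using mult_carrier_mat[OF mult_carrier_mat[OF y b] x]
        mult_carrier_mat[OF mult_carrier_mat[OF x b] y] by auto
    show ?thesis
      unfolding derived_bracket_blocks[OF b y x]
        gl_lower_eq_zero_iff[OF minus_carrier_mat[OF P(2)]] minus_eq_zero_mat_iff[OF P] ..
  qed
  then show ?thesis
    unfolding lie_center_def gl_minus1_space_simps gl_minus1_def by auto
qed

lemma rank_normal_form_commute_units:
  fixes y :: "'a :: field mat"
  assumes r: "r \<le> m" "r \<le> n" and y: "y \<in> carrier_mat n m"
    and comm: "\<forall>x \<in> carrier_mat n m.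
      y * rank_normal_form m n r * x = x * rank_normal_form m n r * y"
    and idx: "i < n" "p < n" "q < m" "j < m"
  shows "(if p < r \<and> j = q then y $$ (i, p) else 0) = (if i = p \<and> q < r then y $$ (q, j) else 0)"
proof -
  \<comment> \<open>The matrix unit at \<open>(p, q)\<close>. It collapses each sum over
    \<open>s < r\<close> to at most one term, which is where the conditions \<open>p < r\<close> and
    \<open>q < r\<close> come from.\<close>
  define E :: "'a mat" where "E = mat n m (\<lambda>(s, t). if s = p \<and> t = q then 1 else 0)"
  have E: "E \<in> carrier_mat n m" unfolding E_def by simp
  have "(y * rank_normal_form m n r * E) $$ (i, j)
      = (\<Sum>s<r. if s = p then (if j = q then y $$ (i, p) else 0) else 0)"
    unfolding index_mult_rank_normal_form[OF r y E idx(1,4)]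
    by (rule sum.cong) (use r idx in \<open>auto simp: E_def\<close>)
  moreover have "(E * rank_normal_form m n r * y) $$ (i, j)
      = (\<Sum>s<r. if s = q then (if i = p then y $$ (q, j) else 0) else 0)"
    unfolding index_mult_rank_normal_form[OF r E y idx(1,4)]
    by (rule sum.cong) (use r idx in \<open>auto simp: E_def\<close>)
  ultimately show ?thesis using comm E by (simp split: if_splits)
qed

text \<open>Here the normal form is the identity, so this is the classical fact that the matrices
  commuting with all square matrices are the scalar ones.\<close>

lemma rank_normal_form_commute_square_iff:
  fixes y :: "'a :: field mat"
  assumes "0 < n" and y: "y \<in> carrier_mat n n"
  shows "(\<forall>x \<in> carrier_mat n n. y * rank_normal_form n n n * x = x * rank_normal_form n n n * y)
    \<longleftrightarrow> (\<exists>\<alpha>. y = \<alpha> \<cdot>\<^sub>m 1\<^sub>m n)" (is "?C \<longleftrightarrow> _")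
proof
  assume C: ?C
  note units = rank_normal_form_commute_units[OF order_refl order_refl y C]
  define \<alpha> where "\<alpha> = y $$ (0, 0)"
  have "y $$ (i, j) = (if i = j then \<alpha> else 0)" if "i < n" "j < n" for i j
    \<comment> \<open>The unit at \<open>(0, i)\<close>, read off at entry \<open>(0, j)\<close>,
      compares every entry of \<open>y\<close> with the corner entry, which exists since
      \<open>0 < n\<close>.\<close>
    unfolding \<alpha>_def using units[of 0 0 i j] that \<open>0 < n\<close> by (auto split: if_splits)
  then have "y = \<alpha> \<cdot>\<^sub>m 1\<^sub>m n" using y by (intro eq_matI) auto
  then show "\<exists>\<alpha>. y = \<alpha> \<cdot>\<^sub>m 1\<^sub>m n" ..
next
  assume "\<exists>\<alpha>. y = \<alpha> \<cdot>\<^sub>m 1\<^sub>m n"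
  moreover have "rank_normal_form n n n = (1\<^sub>m n :: 'a mat)"
    unfolding rank_normal_form_def by (intro eq_matI) auto
  ultimately show ?C
    by (auto simp: mult_smult_assoc_mat[of _ n n _ n] mult_smult_distrib[of _ n n _ n])
qed

text \<open>Treats (b) and (c) together: outside the square full-rank case there is a row or a
  column of index \<open>r\<close>, and testing there kills the common diagonal value.\<close>

lemma rank_normal_form_commute_iff:
  fixes y :: "'a :: field mat"
  assumes r: "r \<le> m" "r \<le> n" and not_square: "\<not> (r = m \<and> r = n)" and y: "y \<in> carrier_mat n m"
  shows "(\<forall>x \<in> carrier_mat n m. y * rank_normal_form m n r * x = x * rank_normal_form m n r * y)
    \<longleftrightarrow> (\<forall>i<n. \<forall>j<m. i < r \<or> j < r \<longrightarrow> y $$ (i, j) = 0)" (is "?C \<longleftrightarrow> ?V")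
proof
  assume C: ?C
  note units = rank_normal_form_commute_units[OF r y C]
  have diag: "y $$ (i, i) = 0" if i: "i < r" for i
  proof (cases "r = n")
    case True
    then have "r < m" using r not_square by simp
    \<comment> \<open>The unit at \<open>(i, r)\<close>, read off at its own position; the other
      case uses \<open>(r, i)\<close> likewise.\<close>
    then show ?thesis using units[of i i r r] i r by simp
  next
    case False
    then have "r < n" using r by simp
    then show ?thesis using units[of r r i i] i r by simp
  qed
  show ?V
  proof (intro allI impI)
    fix i j assume ij: "i < n" "j < m" and low: "i < r \<or> j < r"
    show "y $$ (i, j) = 0"
    proof (cases "i = j")
      case True
      then show ?thesis using diag low by auto
    next
      \<comment> \<open>Off the diagonal, the diagonal unit at \<open>i\<close> handles the first
        \<open>r\<close> rows and the one at \<open>j\<close> the first \<open>r\<close> columns,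
        both read off at \<open>(i, j)\<close>.\<close>
      case False
      from low show ?thesis
      proof
        assume "i < r"
        then show ?thesis using units[of i i i j] ij r False by simp
      next
        assume "j < r"
        then show ?thesis using units[of i j j j] ij r False by simp
      qed
    qed
  qed
next
  assume V: ?V
  show ?C
  proof
    fix x :: "'a mat" assume x: "x \<in> carrier_mat n m"
    let ?b = "rank_normal_form m n r :: 'a mat"
    \<comment> \<open>Each summand has a factor from the first \<open>r\<close> columns or rows of
      \<open>y\<close>, so both sides are zero.\<close>
    have "(y * ?b * x) $$ (i, j) = (x * ?b * y) $$ (i, j)" if "i < n" "j < m" for i j
      unfolding index_mult_rank_normal_form[OF r y x that] index_mult_rank_normal_form[OF r x y that]
      using V that r by simp
    then show "y * ?b * x = x * ?b * y"
      using x y by (intro eq_matI) auto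
  qed
qed

text \<open>Passes from vanishing entries to the block form of (b). The bounds on \<open>r\<close>
  make the natural-number subtractions exact, so the blocks fill an \<open>n\<close> by
  \<open>m\<close> matrix.\<close>

lemma lower_right_block_iff:
  fixes y :: "'a :: zero mat"
  assumes r: "r \<le> m" "r \<le> n"
  shows "y \<in> carrier_mat n m \<and> (\<forall>i<n. \<forall>j<m. i < r \<or> j < r \<longrightarrow> y $$ (i, j) = 0)
    \<longleftrightarrow> (\<exists>y22 \<in> carrier_mat (n - r) (m - r).
      y = four_block_mat (0\<^sub>m r r) (0\<^sub>m r (m - r)) (0\<^sub>m (n - r) r) y22)" (is "?V \<longleftrightarrow> ?B")
proof
  assume V: ?V
  let ?y22 = "mat (n - r) (m - r) (\<lambda>(i, j). y $$ (i + r, j + r))"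
  have "y = four_block_mat (0\<^sub>m r r) (0\<^sub>m r (m - r)) (0\<^sub>m (n - r) r) ?y22"
    using V r by (intro eq_matI) auto
  then show ?B by (intro bexI[of _ ?y22]) simp_all
next
  assume ?B
  then show ?V using r by auto
qed

theorem corollary1:
  fixes m n r :: nat and B :: "'a :: field_char_0 mat" and Z :: "'a mat set"
  assumes "m > 0" and "n > 0" and "r \<le> m" and "r \<le> n"
    and "B = gl_upper m n (rank_normal_form m n r)"
    and "Z = lie_center (gl_minus1_space m n) (derived_bracket m B)"
  shows "(r = m \<and> r = n \<longrightarrow> Z = gl_lower m n ` {\<alpha> \<cdot>\<^sub>m 1\<^sub>m r | \<alpha>. True})
    \<and> (r \<noteq> m \<and> r \<noteq> n \<longrightarrow> Z = gl_lower m n `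
         {four_block_mat (0\<^sub>m r r) (0\<^sub>m r (m - r)) (0\<^sub>m (n - r) r) y22 | y22.
            y22 \<in> carrier_mat (n - r) (m - r)})
    \<and> ((r = m \<or> r = n) \<and> \<not> (r = m \<and> r = n) \<longrightarrow> Z = gl_lower m n ` {0\<^sub>m n m})"
proof -
  note r = assms(3,4)
  let ?C = "{y \<in> carrier_mat n m. \<forall>x \<in> carrier_mat n m.
    y * rank_normal_form m n r * x = x * rank_normal_form m n r * (y :: 'a mat)}"
  \<comment> \<open>With \<open>Z\<close> an image under \<open>gl_lower\<close>, each case becomes
    an equality between sets of blocks.\<close>
  have Z: "Z = gl_lower m n ` ?C"
    unfolding assms(5,6) by (rule lie_center_gl_minus1[OF rank_normal_form_carrier[OF r]])
  have C: "?C = {y \<in> carrier_mat n m. \<forall>i<n. \<forall>j<m. i < r \<or> j < r \<longrightarrow> y $$ (i, j) = 0}"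
    if "\<not> (r = m \<and> r = n)"
    using rank_normal_form_commute_iff[OF r that] by blast
  have a: "?C = {\<alpha> \<cdot>\<^sub>m 1\<^sub>m r | \<alpha>. True}" if "r = m \<and> r = n"
  proof -
    have "m = n" "r = n" using that by auto
    moreover have "\<alpha> \<cdot>\<^sub>m 1\<^sub>m n \<in> carrier_mat n n" for \<alpha> :: 'a by simp
    ultimately show ?thesis
      using rank_normal_form_commute_square_iff[OF \<open>n > 0\<close>, where 'a = 'a] by blast
  qed
  have b: "?C = {four_block_mat (0\<^sub>m r r) (0\<^sub>m r (m - r)) (0\<^sub>m (n - r) r) y22 | y22.
      y22 \<in> carrier_mat (n - r) (m - r)}" if "r \<noteq> m \<and> r \<noteq> n"
  proof -
    have "\<not> (r = m \<and> r = n)" using that by simp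
    then show ?thesis unfolding C[OF \<open>\<not> (r = m \<and> r = n)\<close>] lower_right_block_iff[OF r] by blast
  qed
  have c: "?C = {0\<^sub>m n m}" if "(r = m \<or> r = n) \<and> \<not> (r = m \<and> r = n)"
  proof -
    have ns: "\<not> (r = m \<and> r = n)" using that by simp
    \<comment> \<open>If \<open>r = m\<close> every column index is below \<open>r\<close>, and if
      \<open>r = n\<close> every row index is, so all entries vanish.\<close>
    show ?thesis unfolding C[OF ns] using that by (auto intro!: eq_matI)
  qed
  show ?thesis
    unfolding Z by (intro conjI impI; rule arg_cong[of _ _ "image (gl_lower m n)"]; erule a b c)
qed

end
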